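(* Let $\alpha:\Gamma\curvearrowright X$ be a minimal equicontinuous action of a countable discrete group $\Gamma$ on the Cantor set $X$. Then $\alpha$ is conjugate to a $\Gamma$-subodometer. If the action $\alpha$ is free, then $\Gamma$ is necessarily residually finite.
   Context: A continuous action of $\Gamma$ on a compact metric space $(X,d)$ is equicontinuous if for all $\varepsilon>0$ there exists $\delta>0$ such that $d(x,y)<\delta$ implies $d(gx,gy)<\varepsilon$ for all $g\in\Gamma$ (the choice of compatible metric is irrelevant). An action is minimal if every orbit is dense. Two actions of $\Gamma$ are conjugate if there is a $\Gamma$-equivariant homeomorphism between the spaces. $\Gamma$-subodometer: let $(\Gamma_n)_{n=1}^\infty$ be a strictly decreasing sequence of finite index subgroups of $\Gamma$, let $X_n=\Gamma/\Gamma_n$ be the finite left coset space with $\Gamma$ acting by left multiplication, and let $X_n\leftarrow X_{n+1}$ be the $\Gamma$-equivariant maps induced by the inclusions $\Gamma_n\supset\Gamma_{n+1}$. The $\Gamma$-subodometer associated with $(\Gamma_n)$ is the induced action of $\Gamma$ on the projective limit of $X_1\leftarrow X_2\leftarrow\cdots$ (the subgroups $\Gamma_n$ are not required to be normal). *)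

theory Defs
  imports "HOL-Analysis.Analysis" "HOL-Algebra.Left_Coset" "HOL-Algebra.Group_Action"
begin

text \<open>The Cantor set, as a space up to homeomorphism: \<open>{0,1}\<close>-valued sequences.\<close>

definition cantor_space :: "(nat \<Rightarrow> bool) topology" where
  "cantor_space = product_topology (\<lambda>_. discrete_topology UNIV) UNIV"


section \<open>Actions of a discrete group\<close>

text \<open>Since the group is discrete, continuity of the action means that every group element
  acts by a continuous map.\<close>

definition continuous_action ::
  "('g, 'm) monoid_scheme \<Rightarrow> 'x topology \<Rightarrow> ('g \<Rightarrow> 'x \<Rightarrow> 'x) \<Rightarrow> bool" where
  "continuous_action G T \<phi> \<longleftrightarrow>
     group_action G (topspace T) \<phi> \<and> (\<forall>g\<in>carrier G. continuous_map T T (\<phi> g))"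

definition equicontinuous_action ::
  "('g, 'm) monoid_scheme \<Rightarrow> 'x set \<Rightarrow> ('x \<Rightarrow> 'x \<Rightarrow> real) \<Rightarrow> ('g \<Rightarrow> 'x \<Rightarrow> 'x) \<Rightarrow> bool" where
  "equicontinuous_action G X d \<phi> \<longleftrightarrow>
     (\<forall>\<epsilon>>0. \<exists>\<delta>>0. \<forall>x\<in>X. \<forall>y\<in>X. d x y < \<delta> \<longrightarrow> (\<forall>g\<in>carrier G. d (\<phi> g x) (\<phi> g y) < \<epsilon>))"

definition minimal_action ::
  "('g, 'm) monoid_scheme \<Rightarrow> 'x topology \<Rightarrow> ('g \<Rightarrow> 'x \<Rightarrow> 'x) \<Rightarrow> bool" where
  "minimal_action G T \<phi> \<longleftrightarrow> (\<forall>x\<in>topspace T. T closure_of (orbit G \<phi> x) = topspace T)"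

definition free_action ::
  "('g, 'm) monoid_scheme \<Rightarrow> 'x set \<Rightarrow> ('g \<Rightarrow> 'x \<Rightarrow> 'x) \<Rightarrow> bool" where
  "free_action G X \<phi> \<longleftrightarrow> (\<forall>g\<in>carrier G. \<forall>x\<in>X. \<phi> g x = x \<longrightarrow> g = \<one>\<^bsub>G\<^esub>)"

definition conjugate_actions ::
  "('g, 'm) monoid_scheme \<Rightarrow> 'x topology \<Rightarrow> ('g \<Rightarrow> 'x \<Rightarrow> 'x)
     \<Rightarrow> 'y topology \<Rightarrow> ('g \<Rightarrow> 'y \<Rightarrow> 'y) \<Rightarrow> bool" where
  "conjugate_actions G S \<phi> T \<psi> \<longleftrightarrow>
     (\<exists>h. homeomorphic_map S T h \<and>
          (\<forall>g\<in>carrier G. \<forall>x\<in>topspace S. h (\<phi> g x) = \<psi> g (h x)))"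


section \<open>Finite index and residual finiteness\<close>

definition finite_index_subgroup :: "'g set \<Rightarrow> ('g, 'm) monoid_scheme \<Rightarrow> bool" where
  "finite_index_subgroup H G \<longleftrightarrow> subgroup H G \<and> finite (lcosets\<^bsub>G\<^esub> H)"

definition residually_finite :: "('g, 'm) monoid_scheme \<Rightarrow> bool" where
  "residually_finite G \<longleftrightarrow>
     (\<forall>g\<in>carrier G. g \<noteq> \<one>\<^bsub>G\<^esub> \<longrightarrow> (\<exists>N. N \<lhd> G \<and> finite_index_subgroup N G \<and> g \<notin> N))"


section \<open>Subodometers\<close>

text \<open>Sequences are indexed from \<open>0\<close>, so \<open>H n\<close> is the subgroup usually written with index \<open>n + 1\<close>.\<close>

definition subodometer_sequence :: "('g, 'm) monoid_scheme \<Rightarrow> (nat \<Rightarrow> 'g set) \<Rightarrow> bool" where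
  "subodometer_sequence G H \<longleftrightarrow>
     (\<forall>n. finite_index_subgroup (H n) G) \<and> (\<forall>n. H (Suc n) \<subset> H n)"

text \<open>For subgroups \<open>L \<subseteq> K\<close>, the map from left cosets of \<open>L\<close> to left cosets of \<open>K\<close> induced by
  the inclusion sends \<open>aL\<close> to \<open>aK = (aL)K\<close>; see \<open>coset_map_l_coset\<close> below.\<close>

definition coset_map :: "('g, 'm) monoid_scheme \<Rightarrow> 'g set \<Rightarrow> 'g set \<Rightarrow> 'g set" where
  "coset_map G K C = C <#>\<^bsub>G\<^esub> K"

definition subodometer_space ::
  "('g, 'm) monoid_scheme \<Rightarrow> (nat \<Rightarrow> 'g set) \<Rightarrow> (nat \<Rightarrow> 'g set) topology" where
  "subodometer_space G H =
     subtopology (product_topology (\<lambda>n. discrete_topology (lcosets\<^bsub>G\<^esub> (H n))) UNIV)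
       {x. \<forall>n. x n = coset_map G (H n) (x (Suc n))}"

text \<open>The restriction makes the maps extensional, as \<^locale>\<open>group_action\<close> requires.\<close>

definition subodometer_action ::
  "('g, 'm) monoid_scheme \<Rightarrow> (nat \<Rightarrow> 'g set) \<Rightarrow> 'g \<Rightarrow> (nat \<Rightarrow> 'g set) \<Rightarrow> (nat \<Rightarrow> 'g set)" where
  "subodometer_action G H g =
     (\<lambda>x\<in>topspace (subodometer_space G H). \<lambda>n. g <#\<^bsub>G\<^esub> x n)"

lemma (in group) coset_map_l_coset:
  assumes "subgroup K G" "subgroup L G" "L \<subseteq> K" "a \<in> carrier G"
  shows "coset_map G K (a <#\<^bsub>G\<^esub> L) = a <#\<^bsub>G\<^esub> K"
proof -
  interpret K: subgroup K G by fact
  interpret L: subgroup L G by fact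
  have "coset_map G K (a <#\<^bsub>G\<^esub> L) = a <#\<^bsub>G\<^esub> (L <#> K)"
    using setmult_lcos_assoc[OF L.subset K.subset assms(4)] by (simp add: coset_map_def)
  also have "L <#> K = K"
  proof
    show "L <#> K \<subseteq> K"
      using mono_set_mult[OF assms(3) order_refl, of G K] subgroup_mult_id[OF assms(1)] by simp
    have "k \<in> L <#> K" if "k \<in> K" for k
      unfolding set_mult_def using that L.one_closed l_one[OF K.mem_carrier[OF that]]
      by (intro UN_I[of \<one>] UN_I[of k]) simp_all
    then show "K \<subseteq> L <#> K" by blast
  qed
  finally show ?thesis .
qed

end

theory Submission
  imports Defs
begin

text \<open>
  The argument rests on invariant equivalence relations with open classes, called open
  congruences below.  On a compact space such a relation \<open>R\<close> has only finitely many classes, and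
  the group permutes them.  If the action is minimal, the permutation is transitive, so that
  the classes form the coset space \<open>G / H\<close>, where \<open>H\<close> is the stabiliser of the class of a base
  point \<open>x\<^sub>0\<close> and has finite index.  A decreasing sequence of open congruences that separates
  points therefore identifies the space with the projective limit of the coset spaces: the map
  to the limit is injective because points are separated, and surjective because nested
  nonempty closed sets in a compact space have a common point.

  Such a sequence exists for an equicontinuous action on the Cantor set.  Let \<open>f\<close> be a
  homeomorphism onto the space of binary sequences, and relate \<open>x\<close> and \<open>y\<close> at level \<open>n\<close> if
  \<open>f (g x)\<close> and \<open>f (g y)\<close> agree in the first \<open>n\<close> coordinates for all \<open>g\<close> in \<open>G\<close>.  The relation is
  invariant by construction.  Its classes are open because each coordinate of \<open>f\<close> is uniformly
  locally constant by compactness, and equicontinuity makes \<open>g x\<close> and \<open>g y\<close> close for all \<open>g\<close>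
  at once.  The stabilisers decrease but need not do so strictly.  They cannot become
  stationary, since the space is infinite and hence no class is a single point; so a
  subsequence is strictly decreasing.

  For residual finiteness, the elements that fix every class of an open congruence form a
  normal subgroup of finite index.  If the action is free, then \<open>g x\<^sub>0 \<noteq> x\<^sub>0\<close> for \<open>g \<noteq> 1\<close>, and some
  level of the sequence separates these two points, so that the corresponding normal subgroup
  does not contain \<open>g\<close>.
\<close>

section \<open>Subgroups of finite index\<close>

lemma (in group) finite_lcosets_if_finite_image:
  assumes H: "subgroup H G" and fin: "finite (f ` carrier G)"
    and f: "\<And>a b. \<lbrakk>a \<in> carrier G; b \<in> carrier G; f a = f b\<rbrakk> \<Longrightarrow> inv a \<otimes> b \<in> H"
  shows "finite (lcosets H)"
proof -
  have eq: "a <#\<^bsub>G\<^esub> H = b <#\<^bsub>G\<^esub> H" if "a \<in> carrier G" "b \<in> carrier G" "f a = f b" for a b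
  proof -
    have "b \<in> a <#\<^bsub>G\<^esub> H"
      using subgroup.lcos_module_rev[OF H is_group that(1,2)] f[OF that] by simp
    then show ?thesis
      using l_repr_independence[OF _ that(1) H] by simp
  qed
  define r where "r c = (SOME a. a \<in> carrier G \<and> f a = c)" for c
  have "a <#\<^bsub>G\<^esub> H = r (f a) <#\<^bsub>G\<^esub> H" if "a \<in> carrier G" for a
  proof -
    have "r (f a) \<in> carrier G \<and> f (r (f a)) = f a"
      unfolding r_def by (rule someI[of _ a]) (use that in simp)
    then show ?thesis
      using eq[OF that] by simp
  qed
  then have "lcosets H \<subseteq> (\<lambda>c. r c <#\<^bsub>G\<^esub> H) ` f ` carrier G"
    unfolding LCOSETS_def by blast
  then show ?thesis
    using fin finite_surj by blast
qed


section \<open>Open congruences of a group action\<close>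

locale compact_group_action =
  group_action G "topspace T" \<phi> for G (structure) and T and \<phi> +
  assumes compact: "compact_space T"
begin

sublocale group G
  using group_hom group_hom.axioms(1) by blast

lemma act_closed [simp]: "g \<in> carrier G \<Longrightarrow> x \<in> topspace T \<Longrightarrow> \<phi> g x \<in> topspace T"
  using element_image by blast

lemma act_one [simp]: "x \<in> topspace T \<Longrightarrow> \<phi> \<one> x = x"
  using id_eq_one by (metis restrict_apply')

lemma act_inv [simp]:
  assumes "g \<in> carrier G" "x \<in> topspace T"
  shows "\<phi> (inv g) (\<phi> g x) = x" "\<phi> g (\<phi> (inv g) x) = x"
  using assms composition_rule[of x "inv g" g] composition_rule[of x g "inv g"] by simp_all

text \<open>An open congruence is an invariant equivalence relation all of whose classes are open
  (and hence also closed).\<close>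

definition open_congruence :: "('c \<times> 'c) set \<Rightarrow> bool" where
  "open_congruence R \<longleftrightarrow>
     equiv (topspace T) R \<and>
     (\<forall>x\<in>topspace T. openin T (R `` {x})) \<and>
     (\<forall>g\<in>carrier G. \<forall>x y. (x, y) \<in> R \<longrightarrow> (\<phi> g x, \<phi> g y) \<in> R)"

lemma open_congruenceD:
  assumes "open_congruence R"
  shows "\<And>x y. (x, y) \<in> R \<Longrightarrow> x \<in> topspace T \<and> y \<in> topspace T"
    and "\<And>x. x \<in> topspace T \<Longrightarrow> (x, x) \<in> R"
    and "\<And>x y. (x, y) \<in> R \<Longrightarrow> (y, x) \<in> R"
    and "\<And>x y z. (x, y) \<in> R \<Longrightarrow> (y, z) \<in> R \<Longrightarrow> (x, z) \<in> R"
    and "\<And>x. x \<in> topspace T \<Longrightarrow> openin T (R `` {x})"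
    and "\<And>g x y. g \<in> carrier G \<Longrightarrow> (x, y) \<in> R \<Longrightarrow> (\<phi> g x, \<phi> g y) \<in> R"
  using assms unfolding open_congruence_def
  by (blast dest: equivE refl_onD symD transD)+

lemma open_congruence_closedin:
  assumes R: "open_congruence R" and x: "x \<in> topspace T"
  shows "closedin T (R `` {x})"
proof -
  note D = open_congruenceD[OF R]
  have "topspace T - R `` {x} = (\<Union>y\<in>topspace T - R `` {x}. R `` {y})"
    using D(1-4) by blast
  moreover have "openin T (\<Union>y\<in>topspace T - R `` {x}. R `` {y})"
    using D(5) by (intro openin_Union) blast
  moreover have "R `` {x} \<subseteq> topspace T"
    using D(1) by blast
  ultimately show ?thesis
    by (simp add: closedin_def)
qed

lemma open_congruence_finite_representatives:
  assumes R: "open_congruence R"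
  obtains K where "finite K" "K \<subseteq> topspace T" "topspace T = R `` K"
proof -
  note D = open_congruenceD[OF R]
  let ?U = "(\<lambda>x. R `` {x}) ` topspace T"
  have "\<forall>U\<in>?U. openin T U" "topspace T \<subseteq> \<Union> ?U"
    using D(2,5) by auto
  then obtain F where F: "finite F" "F \<subseteq> ?U" "topspace T \<subseteq> \<Union> F"
    using compact unfolding compact_space_alt by metis
  then obtain K where K: "finite K" "K \<subseteq> topspace T" "F = (\<lambda>x. R `` {x}) ` K"
    by (meson finite_subset_image)
  then have "topspace T = R `` K"
    using F D(1) by blast
  with K that show thesis by blast
qed

lemma open_congruence_finite_choice:
  assumes R: "open_congruence R"
  obtains c where "finite (c ` topspace T)"
    and "\<And>x. x \<in> topspace T \<Longrightarrow> (x, c x) \<in> R"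
proof -
  note D = open_congruenceD[OF R]
  obtain K where K: "finite K" "K \<subseteq> topspace T" "topspace T = R `` K"
    using open_congruence_finite_representatives[OF R] .
  have "\<forall>x\<in>topspace T. \<exists>k. k \<in> K \<and> (x, k) \<in> R"
    using K(3) D(3) by blast
  then obtain c where c: "\<forall>x\<in>topspace T. c x \<in> K \<and> (x, c x) \<in> R"
    by (rule bchoice[THEN exE])
  have "finite (c ` topspace T)"
    by (rule finite_subset[OF _ K(1)]) (use c in blast)
  with c that show thesis by blast
qed

text \<open>The elements that fix all classes of an open congruence.\<close>

definition class_kernel :: "('c \<times> 'c) set \<Rightarrow> 'a set" where
  "class_kernel R = {g \<in> carrier G. \<forall>x\<in>topspace T. (\<phi> g x, x) \<in> R}"

lemma class_kernel_normal:
  assumes R: "open_congruence R"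
  shows "class_kernel R \<lhd> G"
proof -
  note D = open_congruenceD[OF R]
  have sub: "subgroup (class_kernel R) G"
  proof (rule subgroupI)
    show "class_kernel R \<subseteq> carrier G"
      by (auto simp: class_kernel_def)
    have "\<one> \<in> class_kernel R"
      using D(2) by (simp add: class_kernel_def)
    then show "class_kernel R \<noteq> {}" by blast
  next
    fix a assume a: "a \<in> class_kernel R"
    then have ac: "a \<in> carrier G" by (simp add: class_kernel_def)
    have "(\<phi> (inv a) x, x) \<in> R" if x: "x \<in> topspace T" for x
    proof -
      have "(\<phi> a (\<phi> (inv a) x), \<phi> (inv a) x) \<in> R"
        using a ac x by (simp add: class_kernel_def del: act_inv)
      then show ?thesis
        using ac x D(3) by simp
    qed
    then show "inv a \<in> class_kernel R"
      using ac by (simp add: class_kernel_def)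
  next
    fix a b assume ab: "a \<in> class_kernel R" "b \<in> class_kernel R"
    then have c: "a \<in> carrier G" "b \<in> carrier G" by (simp_all add: class_kernel_def)
    have "(\<phi> (a \<otimes> b) x, x) \<in> R" if x: "x \<in> topspace T" for x
    proof -
      have "(\<phi> a (\<phi> b x), \<phi> b x) \<in> R" "(\<phi> b x, x) \<in> R"
        using ab c x by (simp_all add: class_kernel_def)
      then have "(\<phi> a (\<phi> b x), x) \<in> R" by (rule D(4))
      then show ?thesis
        using c x by (simp add: composition_rule)
    qed
    then show "a \<otimes> b \<in> class_kernel R"
      using c by (simp add: class_kernel_def)
  qed
  have "x \<otimes> h \<otimes> inv x \<in> class_kernel R" if x: "x \<in> carrier G" and h: "h \<in> class_kernel R" for x h
  proof -
    have hc: "h \<in> carrier G" using h by (simp add: class_kernel_def)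
    have "(\<phi> (x \<otimes> h \<otimes> inv x) y, y) \<in> R" if y: "y \<in> topspace T" for y
    proof -
      have "(\<phi> h (\<phi> (inv x) y), \<phi> (inv x) y) \<in> R"
        using h x y by (simp add: class_kernel_def)
      then have "(\<phi> x (\<phi> h (\<phi> (inv x) y)), \<phi> x (\<phi> (inv x) y)) \<in> R"
        using D(6) x by blast
      then show ?thesis
        using x hc y by (simp add: composition_rule)
    qed
    then show ?thesis
      using x hc by (simp add: class_kernel_def)
  qed
  with sub show ?thesis
    by (simp add: normal_inv_iff)
qed

lemma class_kernel_finite_index:
  assumes R: "open_congruence R"
  shows "finite_index_subgroup (class_kernel R) G"
proof -
  note D = open_congruenceD[OF R]
  have sub: "subgroup (class_kernel R) G"
    using class_kernel_normal[OF R] by (rule normal_imp_subgroup)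
  obtain K where K: "finite K" "K \<subseteq> topspace T" "topspace T = R `` K"
    using open_congruence_finite_representatives[OF R] .
  obtain c where c: "finite (c ` topspace T)"
    and cR: "\<And>x. x \<in> topspace T \<Longrightarrow> (x, c x) \<in> R"
    using open_congruence_finite_choice[OF R] by blast
  \<comment> \<open>An element acts on the classes through the finite table of values at representatives.\<close>
  define f where "f a = (\<lambda>k\<in>K. c (\<phi> a k))" for a
  have "f ` carrier G \<subseteq> (\<Pi>\<^sub>E k\<in>K. c ` topspace T)"
    using K(2) by (auto simp: f_def)
  moreover have "finite (\<Pi>\<^sub>E k\<in>K. c ` topspace T)"
    using K(1) c by (simp add: finite_PiE)
  ultimately have fin: "finite (f ` carrier G)"
    by (rule finite_subset)
  have "inv a \<otimes> b \<in> class_kernel R"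
    if a: "a \<in> carrier G" and b: "b \<in> carrier G" and fab: "f a = f b" for a b
  proof -
    have "(\<phi> (inv a \<otimes> b) x, x) \<in> R" if x: "x \<in> topspace T" for x
    proof -
      obtain k where k: "k \<in> K" "(k, x) \<in> R" "k \<in> topspace T"
        using x K by blast
      have "c (\<phi> a k) = c (\<phi> b k)"
        using fun_cong[OF fab, of k] k(1) by (simp add: f_def)
      then have "(\<phi> b k, \<phi> a k) \<in> R"
        using cR[of "\<phi> a k"] cR[of "\<phi> b k"] a b k(3) D(3,4) by (metis act_closed)
      moreover have "(\<phi> a k, \<phi> a x) \<in> R" "(\<phi> b x, \<phi> b k) \<in> R"
        using D(3,6) a b k(2) by blast+
      ultimately have "(\<phi> b x, \<phi> a x) \<in> R"
        using D(4) by blast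
      then have "(\<phi> (inv a) (\<phi> b x), \<phi> (inv a) (\<phi> a x)) \<in> R"
        using D(6) a by blast
      then show ?thesis
        using a b x by (simp add: composition_rule)
    qed
    then show ?thesis
      using a b by (simp add: class_kernel_def)
  qed
  then have "finite (lcosets (class_kernel R))"
    by (rule finite_lcosets_if_finite_image[OF sub fin])
  with sub show ?thesis
    by (simp add: finite_index_subgroup_def)
qed

lemma residually_finite_if_separated:
  assumes R: "\<And>n::nat. open_congruence (R n)"
    and sep: "\<And>x y. \<lbrakk>x \<in> topspace T; y \<in> topspace T; \<And>n. (x, y) \<in> R n\<rbrakk> \<Longrightarrow> x = y"
    and free: "free_action G (topspace T) \<phi>" and z: "z \<in> topspace T"
  shows "residually_finite G"
  unfolding residually_finite_def
proof (intro ballI impI)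
  fix g assume g: "g \<in> carrier G" "g \<noteq> \<one>"
  then have "\<phi> g z \<noteq> z"
    using free z unfolding free_action_def by blast
  then obtain n where "(\<phi> g z, z) \<notin> R n"
    using sep[of "\<phi> g z" z] g z by auto
  then have "g \<notin> class_kernel (R n)"
    using z by (auto simp: class_kernel_def)
  then show "\<exists>N. N \<lhd> G \<and> finite_index_subgroup N G \<and> g \<notin> N"
    using class_kernel_normal[OF R] class_kernel_finite_index[OF R] by blast
qed

text \<open>The elements that move \<open>x\<close> into the class of \<open>y\<close>.  For \<open>y = x\<close> this is the stabiliser of the
  class of \<open>x\<close>; in general it is empty or a left coset of that stabiliser.\<close>

definition return_set :: "('c \<times> 'c) set \<Rightarrow> 'c \<Rightarrow> 'c \<Rightarrow> 'a set" where
  "return_set R x y = {g \<in> carrier G. (\<phi> g x, y) \<in> R}"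

lemma return_set_subgroup:
  assumes R: "open_congruence R" and x: "x \<in> topspace T"
  shows "subgroup (return_set R x x) G"
proof (rule subgroupI)
  note D = open_congruenceD[OF R]
  show "return_set R x x \<subseteq> carrier G"
    by (auto simp: return_set_def)
  have "\<one> \<in> return_set R x x"
    using D(2) x by (simp add: return_set_def)
  then show "return_set R x x \<noteq> {}" by blast
  show "inv a \<in> return_set R x x" if "a \<in> return_set R x x" for a
  proof -
    have a: "a \<in> carrier G" "(\<phi> a x, x) \<in> R"
      using that by (simp_all add: return_set_def)
    then have "(\<phi> (inv a) (\<phi> a x), \<phi> (inv a) x) \<in> R"
      using D(6) by blast
    then show ?thesis
      using a x D(3) by (simp add: return_set_def)
  qed
  show "a \<otimes> b \<in> return_set R x x" if "a \<in> return_set R x x" "b \<in> return_set R x x" for a b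
  proof -
    have ab: "a \<in> carrier G" "(\<phi> a x, x) \<in> R" "b \<in> carrier G" "(\<phi> b x, x) \<in> R"
      using that by (simp_all add: return_set_def)
    then have "(\<phi> a (\<phi> b x), \<phi> a x) \<in> R"
      using D(6) by blast
    then show ?thesis
      using ab x D(4)[of "\<phi> a (\<phi> b x)" "\<phi> a x" x] by (simp add: return_set_def composition_rule)
  qed
qed

lemma return_set_eq_l_coset:
  assumes R: "open_congruence R" and x: "x \<in> topspace T" and a: "a \<in> return_set R x y"
  shows "return_set R x y = a <#\<^bsub>G\<^esub> return_set R x x"
proof -
  note D = open_congruenceD[OF R]
  have ac: "a \<in> carrier G" and ay: "(\<phi> a x, y) \<in> R"
    using a by (simp_all add: return_set_def)
  show ?thesis
  proof (intro subset_antisym subsetI)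
    fix g assume "g \<in> return_set R x y"
    then have g: "g \<in> carrier G" "(\<phi> g x, y) \<in> R"
      by (simp_all add: return_set_def)
    then have "(\<phi> g x, \<phi> a x) \<in> R"
      using ay D(3,4) by blast
    then have "(\<phi> (inv a) (\<phi> g x), \<phi> (inv a) (\<phi> a x)) \<in> R"
      using D(6) ac by blast
    then have "inv a \<otimes> g \<in> return_set R x x"
      using ac g x by (simp add: return_set_def composition_rule)
    moreover have "g = a \<otimes> (inv a \<otimes> g)"
      using ac g by (simp flip: m_assoc)
    ultimately show "g \<in> a <#\<^bsub>G\<^esub> return_set R x x"
      unfolding l_coset_def by blast
  next
    fix g assume "g \<in> a <#\<^bsub>G\<^esub> return_set R x x"
    then obtain h where h: "h \<in> carrier G" "(\<phi> h x, x) \<in> R" "g = a \<otimes> h"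
      by (auto simp: l_coset_def return_set_def)
    then have "(\<phi> a (\<phi> h x), \<phi> a x) \<in> R"
      using D(6) ac by blast
    then show "g \<in> return_set R x y"
      using h(1,3) ac x ay D(4)[of "\<phi> a (\<phi> h x)" "\<phi> a x" y] by (simp add: return_set_def composition_rule)
  qed
qed

lemma return_set_act:
  assumes R: "open_congruence R" and x: "x \<in> topspace T"
    and g: "g \<in> carrier G" and a: "a \<in> return_set R x y"
  shows "return_set R x (\<phi> g y) = g <#\<^bsub>G\<^esub> return_set R x y"
proof -
  have ac: "a \<in> carrier G" and ay: "(\<phi> a x, y) \<in> R"
    using a by (simp_all add: return_set_def)
  then have "g \<otimes> a \<in> return_set R x (\<phi> g y)"
    using g x open_congruenceD(6)[OF R g ay] by (simp add: return_set_def composition_rule)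
  then have "return_set R x (\<phi> g y) = (g \<otimes> a) <#\<^bsub>G\<^esub> return_set R x x"
    by (rule return_set_eq_l_coset[OF R x])
  also have "\<dots> = g <#\<^bsub>G\<^esub> (a <#\<^bsub>G\<^esub> return_set R x x)"
    using lcos_m_assoc[OF subgroup.subset[OF return_set_subgroup[OF R x]] g ac] by simp
  finally show ?thesis
    using return_set_eq_l_coset[OF R x a] by simp
qed

lemma return_set_finite_index:
  assumes R: "open_congruence R" and x: "x \<in> topspace T"
  shows "finite_index_subgroup (return_set R x x) G"
proof -
  note D = open_congruenceD[OF R]
  obtain c where c: "finite (c ` topspace T)"
    and cR: "\<And>x. x \<in> topspace T \<Longrightarrow> (x, c x) \<in> R"
    using open_congruence_finite_choice[OF R] by blast
  have fin: "finite ((\<lambda>a. c (\<phi> a x)) ` carrier G)"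
    by (rule finite_subset[OF _ c]) (use x in auto)
  have "inv a \<otimes> b \<in> return_set R x x"
    if a: "a \<in> carrier G" and b: "b \<in> carrier G" and "c (\<phi> a x) = c (\<phi> b x)" for a b
  proof -
    have "(\<phi> b x, \<phi> a x) \<in> R"
      using that(3) cR[of "\<phi> a x"] cR[of "\<phi> b x"] a b x D(3,4) by (metis act_closed)
    then have "(\<phi> (inv a) (\<phi> b x), \<phi> (inv a) (\<phi> a x)) \<in> R"
      using D(6) a by blast
    then show ?thesis
      using a b x by (simp add: return_set_def composition_rule)
  qed
  then have "finite (lcosets (return_set R x x))"
    by (rule finite_lcosets_if_finite_image[OF return_set_subgroup[OF R x] fin])
  then show ?thesis
    using return_set_subgroup[OF R x] by (simp add: finite_index_subgroup_def)
qed

end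


section \<open>Minimal actions with a separating chain of open congruences\<close>

locale compact_minimal_action = compact_group_action +
  assumes minimal: "minimal_action G T \<phi>"
begin

lemma return_set_nonempty:
  assumes R: "open_congruence R" and x: "x \<in> topspace T" and y: "y \<in> topspace T"
  obtains a where "a \<in> return_set R x y"
proof -
  note D = open_congruenceD[OF R]
  have "y \<in> T closure_of (orbit G \<phi> x)"
    using minimal x y by (simp add: minimal_action_def)
  moreover have "openin T (R `` {y})" "y \<in> R `` {y}"
    using D(2,5) y by auto
  ultimately have "\<exists>z. z \<in> orbit G \<phi> x \<and> z \<in> R `` {y}"
    unfolding in_closure_of by blast
  then obtain z where "z \<in> orbit G \<phi> x" "(y, z) \<in> R"
    by blast
  then obtain a where "a \<in> return_set R x y"
    using D(3) by (auto simp: orbit_def return_set_def)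
  with that show thesis by blast
qed

text \<open>By minimality the classes are translates of each other, so a one-point class would make
  all classes points, of which there are only finitely many.\<close>

lemma class_not_singleton:
  assumes R: "open_congruence R" and x: "x \<in> topspace T" and inf: "infinite (topspace T)"
  shows "\<exists>y. (x, y) \<in> R \<and> y \<noteq> x"
proof (rule ccontr)
  note D = open_congruenceD[OF R]
  assume "\<not> (\<exists>y. (x, y) \<in> R \<and> y \<noteq> x)"
  then have single: "y = x" if "(x, y) \<in> R" for y
    using that by metis
  have all: "z = y" if yz: "(y, z) \<in> R" for y z
  proof -
    have y: "y \<in> topspace T" and z: "z \<in> topspace T"
      using D(1) yz by blast+
    obtain a where "a \<in> return_set R x y"
      using return_set_nonempty[OF R x y] by blast
    then have a: "a \<in> carrier G" "(\<phi> a x, y) \<in> R"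
      by (simp_all add: return_set_def)
    have eq: "w = \<phi> a x" if "(\<phi> a x, w) \<in> R" for w
    proof -
      have "(\<phi> (inv a) (\<phi> a x), \<phi> (inv a) w) \<in> R"
        using D(6) a that by blast
      then have "(x, \<phi> (inv a) w) \<in> R"
        using a x by simp
      then have "\<phi> (inv a) w = x"
        by (rule single)
      then show ?thesis
        using act_inv(2)[OF a(1), of w] D(1)[OF that] by simp
    qed
    show ?thesis
      using eq[OF a(2)] eq[OF D(4)[OF a(2) yz]] by simp
  qed
  obtain K where K: "finite K" "K \<subseteq> topspace T" "topspace T = R `` K"
    using open_congruence_finite_representatives[OF R] .
  have "topspace T \<subseteq> K"
  proof
    fix z assume "z \<in> topspace T"
    then obtain y where y: "y \<in> K" "(y, z) \<in> R"
      using K(3) by blast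
    then show "z \<in> K"
      using all[OF y(2)] by simp
  qed
  then show False
    using K(1) inf finite_subset by blast
qed

lemma ex_return_set_psubset:
  assumes R: "\<And>n::nat. open_congruence (R n)" and dec: "decseq R"
    and sep: "\<And>x y. \<lbrakk>x \<in> topspace T; y \<in> topspace T; \<And>n. (x, y) \<in> R n\<rbrakk> \<Longrightarrow> x = y"
    and x: "x \<in> topspace T" and inf: "infinite (topspace T)"
  shows "\<exists>m. n < m \<and> return_set (R m) x x \<subset> return_set (R n) x x"
proof -
  obtain y where y: "(x, y) \<in> R n" "y \<noteq> x"
    using class_not_singleton[OF R x inf] by blast
  have yT: "y \<in> topspace T"
    using open_congruenceD(1)[OF R y(1)] by blast
  obtain k where k: "(x, y) \<notin> R k"
    using sep[OF x yT] y(2) by metis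
  \<comment> \<open>At level \<open>m\<close> the points \<open>x\<close> and \<open>y\<close> are separated, while they are equivalent at level \<open>n\<close>; an
    element that moves \<open>x\<close> into the class of \<open>y\<close> at level \<open>m\<close> distinguishes the stabilisers.\<close>
  define m where "m = max (Suc n) k"
  have Rm: "R m \<subseteq> R n" "R m \<subseteq> R k"
    using dec by (simp_all add: decseq_def m_def)
  note Dm = open_congruenceD[OF R[of m]]
  obtain a where "a \<in> return_set (R m) x y"
    using return_set_nonempty[OF R x yT] by blast
  then have a: "a \<in> carrier G" "(\<phi> a x, y) \<in> R m"
    by (simp_all add: return_set_def)
  have "(\<phi> a x, x) \<in> R n"
    using a(2) Rm(1) y(1) open_congruenceD(3,4)[OF R[of n]] by blast
  then have "a \<in> return_set (R n) x x"
    using a by (simp add: return_set_def)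
  moreover have "a \<notin> return_set (R m) x x"
  proof
    assume "a \<in> return_set (R m) x x"
    then have "(x, y) \<in> R m"
      using a(2) Dm(3,4) unfolding return_set_def by blast
    then show False
      using k Rm(2) by blast
  qed
  moreover have "return_set (R m) x x \<subseteq> return_set (R n) x x"
    using Rm(1) by (auto simp: return_set_def)
  ultimately have "return_set (R m) x x \<subset> return_set (R n) x x"
    by blast
  moreover have "n < m" by (simp add: m_def)
  ultimately show ?thesis by blast
qed

text \<open>The conjugacy sends \<open>y\<close> to the sequence of cosets \<open>return_set (R n) x y\<close>.\<close>

lemma conjugate_to_subodometer:
  assumes R: "\<And>n::nat. open_congruence (R n)" and dec: "decseq R"
    and sep: "\<And>x y. \<lbrakk>x \<in> topspace T; y \<in> topspace T; \<And>n. (x, y) \<in> R n\<rbrakk> \<Longrightarrow> x = y"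
    and x: "x \<in> topspace T"
  defines "H \<equiv> \<lambda>n. return_set (R n) x x"
  shows "conjugate_actions G T \<phi> (subodometer_space G H) (subodometer_action G H)"
proof -
  let ?S = "subodometer_space G H"
  define h where "h y = (\<lambda>n. return_set (R n) x y)" for y
  have Hsub: "subgroup (H n) G" for n
    unfolding H_def by (rule return_set_subgroup[OF R x])
  have HSuc: "H (Suc n) \<subseteq> H n" for n
    using dec by (auto simp: H_def return_set_def decseq_Suc_iff)
  have hcos: "h y n = a <#\<^bsub>G\<^esub> H n" if "a \<in> return_set (R n) x y" for y n a
    unfolding h_def H_def by (rule return_set_eq_l_coset[OF R x that])
  have hlcos: "h y n \<in> lcosets (H n)" if y: "y \<in> topspace T" for y n
  proof -
    obtain a where a: "a \<in> return_set (R n) x y"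
      using return_set_nonempty[OF R x y] by blast
    then have "a \<in> carrier G" by (simp add: return_set_def)
    then show ?thesis
      using hcos[OF a] by (auto simp: LCOSETS_def)
  qed
  have topS: "topspace ?S =
      {z. (\<forall>n. z n \<in> lcosets (H n)) \<and> (\<forall>n. z n = coset_map G (H n) (z (Suc n)))}"
    by (auto simp: subodometer_space_def PiE_UNIV_domain)
  have hS: "h y \<in> topspace ?S" if y: "y \<in> topspace T" for y
  proof -
    have "h y n = coset_map G (H n) (h y (Suc n))" for n
    proof -
      obtain a where a: "a \<in> return_set (R (Suc n)) x y"
        using return_set_nonempty[OF R x y] by blast
      then have ac: "a \<in> carrier G" by (simp add: return_set_def)
      have "a \<in> return_set (R n) x y"
        using a dec by (auto simp: return_set_def decseq_Suc_iff)
      then have "h y n = a <#\<^bsub>G\<^esub> H n" by (rule hcos)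
      then show ?thesis
        using coset_map_l_coset[OF Hsub Hsub HSuc ac] hcos[OF a] by simp
    qed
    then show ?thesis
      using topS hlcos[OF y] by blast
  qed
  have heq: "h y n = h z n \<longleftrightarrow> (y, z) \<in> R n" if y: "y \<in> topspace T" for y z n
  proof
    note D = open_congruenceD[OF R[of n]]
    obtain a where a: "a \<in> return_set (R n) x y"
      using return_set_nonempty[OF R x y] by blast
    {
      assume "h y n = h z n"
      then have "a \<in> return_set (R n) x z"
        using a by (simp add: h_def)
      then show "(y, z) \<in> R n"
        using a D(3,4) unfolding return_set_def by blast
    next
      assume "(y, z) \<in> R n"
      then show "h y n = h z n"
        using D(3,4) unfolding h_def return_set_def by blast
    }
  qed
  have cont: "continuous_map T ?S h"
    unfolding subodometer_space_def continuous_map_in_subtopology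
  proof
    show "continuous_map T
        (product_topology (\<lambda>n. discrete_topology (lcosets (H n))) UNIV) h"
      unfolding continuous_map_componentwise_UNIV
    proof
      fix n
      note D = open_congruenceD[OF R[of n]]
      have "openin T {y \<in> topspace T. h y n \<in> U}" for U
      proof -
        have "{y \<in> topspace T. h y n \<in> U} =
            (\<Union>y\<in>{y \<in> topspace T. h y n \<in> U}. R n `` {y})" (is "?A = ?B")
        proof
          show "?A \<subseteq> ?B"
            using D(2) by blast
          show "?B \<subseteq> ?A"
          proof
            fix z assume "z \<in> ?B"
            then obtain y where y: "y \<in> topspace T" "h y n \<in> U" "(y, z) \<in> R n" by blast
            then have "h z n = h y n" using heq[OF y(1)] by metis
            then show "z \<in> ?A" using y D(1) by auto
          qed
        qed
        moreover have "openin T (\<Union>y\<in>{y \<in> topspace T. h y n \<in> U}. R n `` {y})"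
          using D(5) by (intro openin_Union) blast
        ultimately show ?thesis by simp
      qed
      then show "continuous_map T (discrete_topology (lcosets (H n))) (\<lambda>y. h y n)"
        using hlcos by (auto simp: continuous_map_def)
    qed
    show "h \<in> topspace T \<rightarrow> {z. \<forall>n. z n = coset_map G (H n) (z (Suc n))}"
      using hS topS by blast
  qed
  have "topspace ?S \<subseteq> h ` topspace T"
  proof
    fix z assume z: "z \<in> topspace ?S"
    have "\<forall>n. z n \<in> lcosets\<^bsub>G\<^esub> (H n)"
      using z topS by blast
    then have "\<forall>n. \<exists>a. a \<in> carrier G \<and> z n = a <#\<^bsub>G\<^esub> H n"
      by (auto simp: LCOSETS_def)
    then obtain a where a: "\<And>n. a n \<in> carrier G" "\<And>n. z n = a n <#\<^bsub>G\<^esub> H n"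
      by metis
    have aT: "\<phi> (a n) x \<in> topspace T" for n
      using a(1) x by simp
    have aret: "a n \<in> return_set (R n) x (\<phi> (a n) x)" for n
      using a(1) aT open_congruenceD(2)[OF R] by (simp add: return_set_def)
    have hz: "h (\<phi> (a n) x) n = z n" for n
      using hcos[OF aret] a(2) by simp
    \<comment> \<open>The class at level \<open>n\<close> that corresponds to the coset \<open>z n\<close>.\<close>
    define C where "C n = R n `` {\<phi> (a n) x}" for n
    have "decseq C"
    proof (rule decseq_SucI)
      fix n
      have "coset_map G (H n) (z (Suc n)) = a (Suc n) <#\<^bsub>G\<^esub> H n"
        using coset_map_l_coset[OF Hsub Hsub HSuc a(1)] a(2) by simp
      moreover have "z n = coset_map G (H n) (z (Suc n))"
        using z topS by blast
      ultimately have "z n = a (Suc n) <#\<^bsub>G\<^esub> H n"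
        by (rule trans[rotated])
      then have "a (Suc n) \<in> z n"
        using lcos_self[OF a(1) Hsub] by simp
      then have "a (Suc n) \<in> h (\<phi> (a n) x) n"
        using hz by simp
      then have "(\<phi> (a n) x, \<phi> (a (Suc n)) x) \<in> R n"
        using open_congruenceD(3)[OF R] by (simp add: h_def return_set_def)
      moreover have "R (Suc n) \<subseteq> R n"
        using dec by (simp add: decseq_Suc_iff)
      ultimately show "C (Suc n) \<subseteq> C n"
        using open_congruenceD(4)[OF R[of n]] unfolding C_def by blast
    qed
    moreover have "closedin T (C n)" for n
      unfolding C_def by (rule open_congruence_closedin[OF R aT])
    moreover have "C n \<noteq> {}" for n
      using open_congruenceD(2)[OF R aT] unfolding C_def by blast
    ultimately have "(\<Inter>n. C n) \<noteq> {}"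
      by (intro compact_space_imp_nest[OF compact])
    then obtain y where y: "\<And>n. (\<phi> (a n) x, y) \<in> R n"
      unfolding C_def by blast
    have "h y = z"
      using heq[OF aT] y hz by (metis ext)
    moreover have "y \<in> topspace T"
      using open_congruenceD(1)[OF R y[of 0]] by blast
    ultimately show "z \<in> h ` topspace T" by blast
  qed
  then have surj: "h ` topspace T = topspace ?S"
    using hS by blast
  have inj: "inj_on h (topspace T)"
    using sep heq by (metis inj_onI)
  have "Hausdorff_space ?S"
    unfolding subodometer_space_def
    by (intro Hausdorff_space_subtopology) (simp add: Hausdorff_space_product_topology)
  then have "homeomorphic_map T ?S h"
    by (rule continuous_imp_homeomorphic_map[OF cont compact _ surj inj])
  moreover have "h (\<phi> g y) = subodometer_action G H g (h y)"
    if g: "g \<in> carrier G" and y: "y \<in> topspace T" for g y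
  proof -
    have "h (\<phi> g y) n = g <#\<^bsub>G\<^esub> h y n" for n
    proof -
      obtain a where "a \<in> return_set (R n) x y"
        using return_set_nonempty[OF R x y] by blast
      then show ?thesis
        unfolding h_def by (rule return_set_act[OF R x g])
    qed
    then show ?thesis
      using hS[OF y] by (auto simp: subodometer_action_def)
  qed
  ultimately show ?thesis
    unfolding conjugate_actions_def by blast
qed

lemma ex_conjugate_subodometer:
  assumes R: "\<And>n::nat. open_congruence (R n)" and dec: "decseq R"
    and sep: "\<And>x y. \<lbrakk>x \<in> topspace T; y \<in> topspace T; \<And>n. (x, y) \<in> R n\<rbrakk> \<Longrightarrow> x = y"
    and inf: "infinite (topspace T)"
  shows "\<exists>H. subodometer_sequence G H \<and>
             conjugate_actions G T \<phi> (subodometer_space G H) (subodometer_action G H)"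
proof -
  obtain x where x: "x \<in> topspace T"
    using inf by fastforce
  have "\<forall>n. \<exists>m. n < m \<and> return_set (R m) x x \<subset> return_set (R n) x x"
    using ex_return_set_psubset[of R, OF R dec sep x inf] by fast
  then obtain t where t: "\<And>n. n < t n \<and> return_set (R (t n)) x x \<subset> return_set (R n) x x"
    by metis
  define s where "s n = (t ^^ n) 0" for n
  have s: "s n < s (Suc n)"
    and strict: "return_set (R (s (Suc n))) x x \<subset> return_set (R (s n)) x x" for n
    using t[of "s n"] by (simp_all add: s_def)
  have mono: "strict_mono s"
    using s by (simp add: strict_mono_Suc_iff)
  have dec': "decseq (\<lambda>n. R (s n))"
    using dec s by (intro decseq_SucI) (simp add: decseq_def less_imp_le)
  have sep': "y = z"
    if "y \<in> topspace T" "z \<in> topspace T" "\<And>n. (y, z) \<in> R (s n)" for y z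
  proof (rule sep[OF that(1,2)])
    fix n
    have "R (s n) \<subseteq> R n"
      using dec strict_mono_imp_increasing[OF mono] by (simp add: decseq_def)
    then show "(y, z) \<in> R n"
      using that(3) by blast
  qed
  have "subodometer_sequence G (\<lambda>n. return_set (R (s n)) x x)"
    unfolding subodometer_sequence_def
    using return_set_finite_index[OF R x] strict by blast
  moreover have "conjugate_actions G T \<phi>
      (subodometer_space G (\<lambda>n. return_set (R (s n)) x x))
      (subodometer_action G (\<lambda>n. return_set (R (s n)) x x))"
    by (rule conjugate_to_subodometer[OF R dec' sep' x])
  ultimately show ?thesis by blast
qed

end


section \<open>Equicontinuous actions on the Cantor set\<close>

lemma topspace_cantor_space [simp]: "topspace cantor_space = UNIV"
  by (simp add: cantor_space_def PiE_UNIV_domain)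

lemma compact_space_cantor_space: "compact_space cantor_space"
  by (simp add: cantor_space_def compact_space_product_topology compact_space_discrete_topology)

lemma infinite_UNIV_bool_sequences: "infinite (UNIV :: (nat \<Rightarrow> bool) set)"
proof
  assume "finite (UNIV :: (nat \<Rightarrow> bool) set)"
  then have "finite (range (\<lambda>n::nat. (=) n))"
    by (rule finite_subset[OF subset_UNIV])
  moreover have "inj (\<lambda>n::nat. (=) n)"
    by (rule injI) metis
  ultimately show False
    using finite_imageD infinite_UNIV_nat by blast
qed

text \<open>A continuous map from a compact metric space to a discrete space is uniformly locally
  constant.\<close>

lemma (in Metric_space) uniformly_locally_constant:
  assumes comp: "compact_space mtopology"
    and f: "continuous_map mtopology (discrete_topology D) f"
  obtains \<epsilon> where "\<epsilon> > 0" "\<And>x y. \<lbrakk>x \<in> M; y \<in> M; d x y < \<epsilon>\<rbrakk> \<Longrightarrow> f x = f y"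
proof -
  let ?C = "(\<lambda>c. {x \<in> M. f x \<in> {c}}) ` D"
  have fD: "f x \<in> D" if "x \<in> M" for x
    using f that by (auto simp: continuous_map_def)
  have op: "openin mtopology U" if "U \<in> ?C" for U
    using that f by (auto simp: continuous_map_def)
  obtain \<epsilon> where \<epsilon>: "\<epsilon> > 0" "\<forall>x\<in>M. \<exists>U\<in>?C. mball x \<epsilon> \<subseteq> U"
    using lebesgue_number[of M ?C, OF _ _ op] comp fD by (auto simp: compact_space_def)
  have "f x = f y" if xy: "x \<in> M" "y \<in> M" "d x y < \<epsilon>" for x y
  proof -
    obtain c where "mball x \<epsilon> \<subseteq> {z \<in> M. f z \<in> {c}}"
      using \<epsilon>(2) xy(1) by blast
    moreover have "x \<in> mball x \<epsilon>" "y \<in> mball x \<epsilon>"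
      using xy \<epsilon>(1) by auto
    ultimately show ?thesis by blast
  qed
  with \<epsilon>(1) that show thesis by blast
qed

text \<open>The relation at level \<open>n\<close>: the codes of all translates agree in the first \<open>n\<close> coordinates.\<close>

definition coding_relation ::
  "('g, 'm) monoid_scheme \<Rightarrow> 'x set \<Rightarrow> ('g \<Rightarrow> 'x \<Rightarrow> 'x) \<Rightarrow> ('x \<Rightarrow> nat \<Rightarrow> 'c) \<Rightarrow> nat \<Rightarrow> ('x \<times> 'x) set"
  where
  "coding_relation G X \<phi> f n =
     {(x, y). x \<in> X \<and> y \<in> X \<and> (\<forall>g\<in>carrier G. \<forall>i<n. f (\<phi> g x) i = f (\<phi> g y) i)}"

lemma decseq_coding_relation: "decseq (coding_relation G X \<phi> f)"
  by (rule decseq_SucI) (auto simp: coding_relation_def)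

lemma open_congruence_coding_relation:
  fixes G (structure)
  assumes act: "compact_group_action G (Metric_space.mtopology X d) \<phi>"
    and metric: "Metric_space X d"
    and equi: "equicontinuous_action G X d \<phi>"
    and f: "\<And>i. continuous_map (Metric_space.mtopology X d) (discrete_topology D) (\<lambda>x. f x i)"
  shows "compact_group_action.open_congruence G (Metric_space.mtopology X d) \<phi>
           (coding_relation G X \<phi> f n)"
proof -
  interpret Metric_space X d by fact
  interpret compact_group_action G mtopology \<phi> by fact
  let ?R = "coding_relation G X \<phi> f n"
  have "\<exists>\<epsilon>>0. \<forall>x\<in>X. \<forall>y\<in>X. d x y < \<epsilon> \<longrightarrow> f x i = f y i" for i
    using uniformly_locally_constant[OF compact f] by metis
  then obtain e where e: "\<And>i. e i > 0"
    and ef: "\<And>i x y. \<lbrakk>x \<in> X; y \<in> X; d x y < e i\<rbrakk> \<Longrightarrow> f x i = f y i"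
    by metis
  define \<epsilon> where "\<epsilon> = Min (insert 1 (e ` {..<n}))"
  have "\<epsilon> > 0"
    using e by (auto simp: \<epsilon>_def)
  have \<epsilon>: "\<epsilon> \<le> e i" if "i < n" for i
    using that by (simp add: \<epsilon>_def)
  obtain \<delta> where \<delta>: "\<delta> > 0"
    and eq: "\<And>x y g. \<lbrakk>x \<in> X; y \<in> X; d x y < \<delta>; g \<in> carrier G\<rbrakk> \<Longrightarrow> d (\<phi> g x) (\<phi> g y) < \<epsilon>"
    using equi \<open>\<epsilon> > 0\<close> unfolding equicontinuous_action_def by metis
  have near: "(x, y) \<in> ?R" if "x \<in> X" "y \<in> X" "d x y < \<delta>" for x y
    unfolding coding_relation_def
  proof (simp add: that(1,2), intro ballI allI impI)
    fix g i assume g: "g \<in> carrier G" and i: "i < n"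
    have "d (\<phi> g x) (\<phi> g y) < e i"
      using eq[OF that g] \<epsilon>[OF i] by simp
    then show "f (\<phi> g x) i = f (\<phi> g y) i"
      using act_closed[OF g] that by (intro ef) simp_all
  qed
  have open_class: "openin mtopology (?R `` {x})" if x: "x \<in> X" for x
    unfolding openin_mtopology
  proof (intro conjI allI impI)
    show "?R `` {x} \<subseteq> X"
      by (auto simp: coding_relation_def)
    fix y assume y: "y \<in> ?R `` {x}"
    have "mball y \<delta> \<subseteq> ?R `` {x}"
    proof
      fix z assume "z \<in> mball y \<delta>"
      then have "(y, z) \<in> ?R"
        by (intro near) auto
      with y show "z \<in> ?R `` {x}"
        by (auto simp: coding_relation_def)
    qed
    with \<delta> show "\<exists>r>0. mball y r \<subseteq> ?R `` {x}" by blast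
  qed
  have "equiv X ?R"
    by (intro equivI refl_onI symI transI) (auto simp: coding_relation_def)
  moreover have "(\<phi> g x, \<phi> g y) \<in> ?R" if g: "g \<in> carrier G" and xy: "(x, y) \<in> ?R" for g x y
  proof -
    have X: "x \<in> X" "y \<in> X"
      using xy by (auto simp: coding_relation_def)
    have "f (\<phi> k (\<phi> g x)) i = f (\<phi> k (\<phi> g y)) i" if "k \<in> carrier G" "i < n" for k i
    proof -
      have "f (\<phi> (k \<otimes> g) x) i = f (\<phi> (k \<otimes> g) y) i"
        using xy that g by (simp add: coding_relation_def)
      then show ?thesis
        using that(1) g X by (simp add: composition_rule)
    qed
    then show ?thesis
      using g X act_closed by (simp add: coding_relation_def)
  qed
  ultimately show ?thesis
    unfolding open_congruence_def using open_class by simp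
qed

theorem proposition3p9:
  fixes G :: "('g, 'm) monoid_scheme"
    and X :: "'x set" and d :: "'x \<Rightarrow> 'x \<Rightarrow> real"
    and \<alpha> :: "'g \<Rightarrow> 'x \<Rightarrow> 'x"
  assumes "group G" and "countable (carrier G)"
    and "Metric_space X d"
    and "Metric_space.mtopology X d homeomorphic_space cantor_space"
    and "continuous_action G (Metric_space.mtopology X d) \<alpha>"
    and "minimal_action G (Metric_space.mtopology X d) \<alpha>"
    and "equicontinuous_action G X d \<alpha>"
  shows "(\<exists>H. subodometer_sequence G H \<and>
              conjugate_actions G (Metric_space.mtopology X d) \<alpha>
                (subodometer_space G H) (subodometer_action G H)) \<and>
         (free_action G X \<alpha> \<longrightarrow> residually_finite G)"
proof -
  interpret Metric_space X d by fact
  have comp: "compact_space mtopology"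
    using assms(4) compact_space_cantor_space homeomorphic_compact_space by blast
  have ga: "group_action G (topspace mtopology) \<alpha>"
    using assms(5) unfolding continuous_action_def by blast
  interpret compact_minimal_action G mtopology \<alpha>
    by (intro compact_minimal_action.intro compact_group_action.intro
        compact_group_action_axioms.intro compact_minimal_action_axioms.intro ga comp assms(6))
  obtain f where f: "homeomorphic_map mtopology cantor_space f"
    using assms(4) homeomorphic_space by blast
  have inj: "inj_on f X" and surj: "f ` X = UNIV"
    using homeomorphic_imp_injective_map[OF f] homeomorphic_imp_surjective_map[OF f] by simp_all
  have "continuous_map mtopology cantor_space f"
    using f homeomorphic_imp_continuous_map by blast
  then have cont: "continuous_map mtopology (discrete_topology UNIV) (\<lambda>x. f x i)" for i
    by (simp add: cantor_space_def continuous_map_componentwise_UNIV)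
  have inf: "infinite X"
    using surj infinite_UNIV_bool_sequences by (metis finite_imageI)
  let ?R = "coding_relation G X \<alpha> f"
  have R: "open_congruence (?R n)" for n
    by (rule open_congruence_coding_relation[OF compact_group_action_axioms assms(3,7) cont])
  have sep: "x = y"
    if "x \<in> topspace mtopology" "y \<in> topspace mtopology" and xy: "\<And>n. (x, y) \<in> ?R n" for x y
  proof -
    have X: "x \<in> X" "y \<in> X"
      using that by simp_all
    have "f (\<alpha> \<one>\<^bsub>G\<^esub> x) i = f (\<alpha> \<one>\<^bsub>G\<^esub> y) i" for i
      using xy[of "Suc i"] one_closed lessI unfolding coding_relation_def by blast
    then have "f x = f y"
      using X by (intro ext) simp
    then show ?thesis
      using inj X by (simp add: inj_on_eq_iff)
  qed
  have "\<exists>H. subodometer_sequence G H \<and>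
          conjugate_actions G mtopology \<alpha> (subodometer_space G H) (subodometer_action G H)"
    by (rule ex_conjugate_subodometer[OF R decseq_coding_relation sep]) (use inf in simp_all)
  moreover have "residually_finite G" if free: "free_action G X \<alpha>"
  proof -
    obtain x0 where x0: "x0 \<in> topspace mtopology"
      using inf by fastforce
    have "free_action G (topspace mtopology) \<alpha>"
      using free by simp
    from residually_finite_if_separated[of ?R, OF R sep this x0] show ?thesis .
  qed
  ultimately show ?thesis by blast
qed

end
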